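(* Suppose that $\mathsf{E}X=0$, $\mathrm{Var}\,X=\sigma^2<\infty$ (with $\sigma\ge 0$), let $r>1$ and let $a$ be a real number. Then $$\sum_{n=1}^{\infty}n^{r-2}(\log n)^a\,\mathsf{P}\big(M_n\le \epsilon\sqrt{n/\log n}\big)<\infty\quad\text{for all } \epsilon>0 \text{ with } \epsilon<\sigma\sqrt{\frac{\pi^2}{8(r-1)}},$$ and $$\sum_{n=1}^{\infty}n^{r-2}(\log n)^a\,\mathsf{P}\big(M_n\le \epsilon\sqrt{n/\log n}\big)=\infty\quad\text{for all } \epsilon>\sigma\sqrt{\frac{\pi^2}{8(r-1)}}.$$
   Context: $X,X_1,X_2,\ldots$ are i.i.d. real random variables; $S_n=\sum_{k=1}^nX_k$ and $M_n=\max_{1\le k\le n}|S_k|$ for $n\ge1$. The convention $\log x=\ln(\max(x,e))$ is used (so $\log 1=\log 2=1$). *)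

theory Defs
  imports "HOL-Probability.Probability"
begin

definition Log :: "real \<Rightarrow> real" where
  "Log x = ln (max x (exp 1))"

definition partial_sum :: "(nat \<Rightarrow> 'a \<Rightarrow> real) \<Rightarrow> nat \<Rightarrow> 'a \<Rightarrow> real" where
  "partial_sum X n \<omega> = (\<Sum>k=1..n. X k \<omega>)"

text \<open>The value at \<open>n = 0\<close> is a maximum over the empty set and carries no meaning.\<close>

definition max_abs_sum :: "(nat \<Rightarrow> 'a \<Rightarrow> real) \<Rightarrow> nat \<Rightarrow> 'a \<Rightarrow> real" where
  "max_abs_sum X n \<omega> = Max ((\<lambda>k. \<bar>partial_sum X k \<omega>\<bar>) ` {1..n})"

text \<open>The family is indexed by all naturals: \<open>X 0\<close> is the generic copy \<open>X\<close> and
  \<open>X k\<close>, \<open>k \<ge> 1\<close>, are the summands. Measurability of each \<open>X k\<close> is part of \<open>indep_vars\<close>.\<close>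

definition iid :: "'a measure \<Rightarrow> (nat \<Rightarrow> 'a \<Rightarrow> real) \<Rightarrow> bool" where
  "iid M X \<longleftrightarrow> prob_space.indep_vars M (\<lambda>_. borel) X UNIV \<and>
     (\<forall>k. distr M borel (X k) = distr M borel (X 0))"

text \<open>The series over \<open>n \<ge> 1\<close>, taken in \<open>[0, \<infinity>]\<close>; its terms are nonnegative.\<close>

definition small_dev_series ::
    "'a measure \<Rightarrow> (nat \<Rightarrow> 'a \<Rightarrow> real) \<Rightarrow> real \<Rightarrow> real \<Rightarrow> real \<Rightarrow> ennreal" where
  "small_dev_series M X r a \<epsilon> =
     (\<Sum>i. let n = Suc i in
        ennreal (real n powr (r - 2) * Log (real n) powr a *
          \<P>(\<omega> in M. max_abs_sum X n \<omega> \<le> \<epsilon> * sqrt (real n / Log (real n)))))"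

end

theory Submission
  imports Defs "HOL-Real_Asymp.Real_Asymp"
begin

text \<open>
  Write \<open>x = \<epsilon> sqrt (n / log n)\<close>, and let \<open>C\<close>, \<open>D\<close> be the expectations of \<open>cos (\<theta> X)\<close> and
  \<open>sin (\<theta> X)\<close>. The function \<open>cos (\<theta> y)\<close> is almost an eigenfunction of the step operator
  \<open>f \<mapsto> E f(y + X)\<close>, with eigenvalue \<open>C\<close>, since \<open>D = o(\<theta>\<^sup>2)\<close>. For \<open>\<theta>\<close> slightly below \<open>\<pi> / (2 x)\<close> it
  is bounded below on \<open>[-x, x]\<close>, which absorbs the error terms and bounds the probability of
  staying in \<open>[-x, x]\<close> for \<open>n\<close> steps by a constant times \<open>(C + o(\<theta>\<^sup>2))\<^sup>n\<close>. For \<open>\<theta>\<close> slightly above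
  \<open>\<pi> / (2 x)\<close>, the function \<open>cos (\<theta> y) + \<eta>\<close> with \<open>\<eta> = - cos (\<theta> x)\<close> is nonpositive just outside
  \<open>[-x, x]\<close> and gains \<open>\<eta> (1 - C)\<close> in each step, which again dominates the errors and gives the lower
  bound \<open>C\<^sup>n\<close>. Long jumps cost only \<open>P(\<bar>X\<bar> > d x) = o(x\<^sup>-\<^sup>2)\<close>. As \<open>1 - C \<sim> \<sigma>\<^sup>2 \<theta>\<^sup>2 / 2\<close>, the
  probability is \<open>n\<close> to the power \<open>- \<pi>\<^sup>2 \<sigma>\<^sup>2 / (8 \<epsilon>\<^sup>2) + o(1)\<close>.
\<close>

section \<open>Survival of a path in \<open>[-x, x]\<close>\<close>

text \<open>The indicator of \<open>M_n \<le> x\<close>; unlike \<open>max_abs_sum\<close> it is meaningful for \<open>n = 0\<close>.\<close>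

definition survive :: "(nat \<Rightarrow> 'a \<Rightarrow> real) \<Rightarrow> real \<Rightarrow> nat \<Rightarrow> 'a \<Rightarrow> real" where
  "survive X x n \<omega> = of_bool (\<forall>k\<in>{1..n}. \<bar>partial_sum X k \<omega>\<bar> \<le> x)"

lemma partial_sum_0 [simp]: "partial_sum X 0 \<omega> = 0"
  by (simp add: partial_sum_def)

lemma partial_sum_Suc [simp]: "partial_sum X (Suc n) \<omega> = partial_sum X n \<omega> + X (Suc n) \<omega>"
  by (simp add: partial_sum_def)

lemma survive_0 [simp]: "survive X x 0 \<omega> = 1"
  by (simp add: survive_def)

lemma survive_Suc:
  "survive X x (Suc n) \<omega> = survive X x n \<omega> * of_bool (\<bar>partial_sum X (Suc n) \<omega>\<bar> \<le> x)"
proof -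
  have "(\<forall>k\<in>{1..Suc n}. \<bar>partial_sum X k \<omega>\<bar> \<le> x) \<longleftrightarrow>
      (\<forall>k\<in>{1..n}. \<bar>partial_sum X k \<omega>\<bar> \<le> x) \<and> \<bar>partial_sum X (Suc n) \<omega>\<bar> \<le> x"
    by (subst atLeastAtMostSuc_conv) (simp, blast)
  then show ?thesis
    unfolding survive_def of_bool_conj[symmetric] by (rule arg_cong)
qed

lemma survive_cases: "survive X x n \<omega> = 0 \<or> survive X x n \<omega> = 1"
  by (metis of_bool_def survive_def)

lemma survive_nonneg [simp]: "0 \<le> survive X x n \<omega>" and survive_le_1 [simp]: "survive X x n \<omega> \<le> 1"
  by (simp_all add: survive_def)

text \<open>For \<open>n = 0\<close> the indicator carries no information, and it is
  \<open>x > 0\<close> that covers the sum \<open>0\<close>.\<close>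

lemma survive_bound:
  assumes "survive X x n \<omega> \<noteq> 0" "x > 0"
  shows "\<bar>partial_sum X n \<omega>\<bar> \<le> x"
  using assms by (cases n) (auto simp: survive_def split: if_splits simp del: partial_sum_Suc)

lemma measurable_partial_sum [measurable]:
  assumes "\<And>i. i \<in> {1..n} \<Longrightarrow> X i \<in> borel_measurable M"
  shows "partial_sum X n \<in> borel_measurable M"
  unfolding partial_sum_def[abs_def] using assms by (intro borel_measurable_sum) auto

lemma measurable_survive [measurable]:
  assumes "\<And>i. i \<in> {1..n} \<Longrightarrow> X i \<in> borel_measurable M"
  shows "survive X x n \<in> borel_measurable M"
  using assms
proof (induction n)
  case (Suc n)
  have [measurable]: "partial_sum X (Suc n) \<in> borel_measurable M"
    by (rule measurable_partial_sum) (use Suc in auto)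
  have [measurable]: "survive X x n \<in> borel_measurable M"
    using Suc by auto
  show ?case
    unfolding survive_Suc[abs_def] of_bool_def by measurable
qed (simp add: survive_def[abs_def])

text \<open>Supplies the positivity of the offset \<eta> in the lower bound.\<close>

lemma cos_beyond_right_angle_neg:
  assumes "0 < \<delta>" "\<delta> < 2"
  shows "cos (pi * (1 + \<delta>) / 2) < 0"
proof -
  have "cos (pi * (1 + \<delta>) / 2) = - sin (pi * \<delta> / 2)"
    by (simp add: ring_distribs add_divide_distrib cos_add)
  moreover have "sin (pi * \<delta> / 2) > 0"
    using assms by (intro sin_gt_zero) (auto simp: field_simps)
  ultimately show ?thesis by simp
qed

section \<open>The walk and the independence of its next step\<close>

locale centered_walk = prob_space M for M :: "'a measure" +
  fixes X :: "nat \<Rightarrow> 'a \<Rightarrow> real" and V :: real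
  assumes iid: "iid M X"
    and integrable_X: "integrable M (X 0)"
    and mean_X: "expectation (X 0) = 0"
    and integrable_X2: "integrable M (\<lambda>\<omega>. (X 0 \<omega>)\<^sup>2)"
    and second_moment: "expectation (\<lambda>\<omega>. (X 0 \<omega>)\<^sup>2) = V"
begin

lemma indep: "indep_vars (\<lambda>_. borel) X UNIV"
  using iid by (simp add: iid_def)

lemma measurable_X [measurable]: "X k \<in> borel_measurable M"
  using indep by (auto simp: indep_vars_def)

lemma measurable_walk [measurable]: "partial_sum X n \<in> borel_measurable M" "survive X x n \<in> borel_measurable M"
  by (auto intro: measurable_partial_sum measurable_survive)

lemma expectation_X_cong:
  assumes [measurable]: "v \<in> borel_measurable borel"
  shows "expectation (\<lambda>\<omega>. v (X k \<omega>)) = expectation (\<lambda>\<omega>. v (X 0 \<omega>) :: real)"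
proof -
  have "expectation (\<lambda>\<omega>. v (X k \<omega>)) = integral\<^sup>L (distr M borel (X k)) v"
    by (simp add: integral_distr)
  also have "\<dots> = integral\<^sup>L (distr M borel (X 0)) v"
    using iid unfolding iid_def by metis
  also have "\<dots> = expectation (\<lambda>\<omega>. v (X 0 \<omega>))"
    by (simp add: integral_distr)
  finally show ?thesis .
qed

lemma integrable_survive_step:
  assumes [measurable]: "g \<in> borel_measurable borel" "v \<in> borel_measurable borel"
    and "\<And>y. \<bar>g y\<bar> \<le> B" "\<And>y. \<bar>v y\<bar> \<le> C"
  shows "integrable M (\<lambda>\<omega>. survive X x n \<omega> * g (partial_sum X m \<omega>) * v (X k \<omega>) :: real)"
proof (rule integrable_const_bound[where B = "1 * B * C"])
  have "\<bar>survive X x n \<omega> * g (partial_sum X m \<omega>) * v (X k \<omega>)\<bar> \<le> 1 * B * C" for \<omega>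
    unfolding abs_mult using order_trans[OF abs_ge_zero assms(3)[of 0]] assms(3,4)
    by (intro mult_mono) auto
  then show "AE \<omega> in M. norm (survive X x n \<omega> * g (partial_sum X m \<omega>) * v (X k \<omega>)) \<le> 1 * B * C"
    by simp
qed measurable

text \<open>Survival up to time \<open>n\<close> and the position at time \<open>n\<close> are
  functions of \<open>X 1\<close>, ..., \<open>X n\<close>, hence independent of the next
  step.\<close>

lemma expectation_survive_step:
  assumes [measurable]: "g \<in> borel_measurable borel" "v \<in> borel_measurable borel"
    and g: "\<And>y. \<bar>g y\<bar> \<le> B" and v: "\<And>y. \<bar>v y\<bar> \<le> C"
  shows "expectation (\<lambda>\<omega>. survive X x n \<omega> * g (partial_sum X n \<omega>) * v (X (Suc n) \<omega>)) =
    expectation (\<lambda>\<omega>. survive X x n \<omega> * g (partial_sum X n \<omega>)) * expectation (\<lambda>\<omega>. v (X 0 \<omega>) :: real)"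
proof -
  \<comment> \<open>Taking the coordinate maps \<open>\<lambda>i f. f i\<close> as the process turns
    \<open>survive\<close> and \<open>partial_sum\<close> into functions on the product space, to
    which independence of disjoint blocks applies.\<close>
  let ?Y = "\<lambda>f. survive (\<lambda>i f. f i) x n f * g (partial_sum (\<lambda>i f. f i) n f)"
  let ?r = "\<lambda>A \<omega>. restrict (\<lambda>i. X i \<omega>) A"
  have [measurable]: "survive (\<lambda>i f. f i) x n \<in> borel_measurable (PiM {1..n} (\<lambda>_. borel))"
      "partial_sum (\<lambda>i f. f i) n \<in> borel_measurable (PiM {1..n} (\<lambda>_. borel))"
    by (auto intro!: measurable_survive measurable_partial_sum measurable_component_singleton)
  have "indep_var borel (?Y \<circ> ?r {1..n}) borel ((\<lambda>f. v (f (Suc n))) \<circ> ?r {Suc n})"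
    by (rule indep_var_compose[OF indep_var_restrict[OF indep]]) auto
  also have "?Y \<circ> ?r {1..n} = (\<lambda>\<omega>. survive X x n \<omega> * g (partial_sum X n \<omega>))"
    by (auto simp: fun_eq_iff survive_def partial_sum_def)
  also have "(\<lambda>f. v (f (Suc n))) \<circ> ?r {Suc n} = (\<lambda>\<omega>. v (X (Suc n) \<omega>))"
    by auto
  finally have ind: "indep_var borel (\<lambda>\<omega>. survive X x n \<omega> * g (partial_sum X n \<omega>))
      borel (\<lambda>\<omega>. v (X (Suc n) \<omega>))" .
  \<comment> \<open>Integrability of the two factors comes from the three-factor lemma with a factor
    set to \<open>1\<close>; for the second one the horizon is \<open>0\<close>, where
    \<open>survive\<close> is \<open>1\<close>.\<close>
  show ?thesis
    using integrable_survive_step[of g "\<lambda>_. 1" B 1 x n n 0] g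
      integrable_survive_step[of "\<lambda>_. 1" v 1 C x 0 0 "Suc n"] v
    by (subst indep_var_lebesgue_integral[OF ind])
       (auto simp: expectation_X_cong[of v "Suc n"])
qed

text \<open>The addition formula for \<open>cos\<close>, split by independence. The sine term
  measures how far the cosine is from being an exact eigenfunction when the step is not
  symmetric.\<close>

lemma expectation_survive_cos:
  "expectation (\<lambda>\<omega>. survive X x n \<omega> * cos (\<theta> * partial_sum X (Suc n) \<omega>)) =
    expectation (\<lambda>\<omega>. survive X x n \<omega> * cos (\<theta> * partial_sum X n \<omega>)) * expectation (\<lambda>\<omega>. cos (\<theta> * X 0 \<omega>)) -
    expectation (\<lambda>\<omega>. survive X x n \<omega> * sin (\<theta> * partial_sum X n \<omega>)) * expectation (\<lambda>\<omega>. sin (\<theta> * X 0 \<omega>))"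
proof -
  have "expectation (\<lambda>\<omega>. survive X x n \<omega> * cos (\<theta> * partial_sum X (Suc n) \<omega>)) =
     expectation (\<lambda>\<omega>. survive X x n \<omega> * cos (\<theta> * partial_sum X n \<omega>) * cos (\<theta> * X (Suc n) \<omega>) -
       survive X x n \<omega> * sin (\<theta> * partial_sum X n \<omega>) * sin (\<theta> * X (Suc n) \<omega>))"
    by (simp add: cos_add algebra_simps)
  also have "\<dots> = expectation (\<lambda>\<omega>. survive X x n \<omega> * cos (\<theta> * partial_sum X n \<omega>) * cos (\<theta> * X (Suc n) \<omega>)) -
      expectation (\<lambda>\<omega>. survive X x n \<omega> * sin (\<theta> * partial_sum X n \<omega>) * sin (\<theta> * X (Suc n) \<omega>))"
    by (intro Bochner_Integration.integral_diff
      integrable_survive_step[of "\<lambda>y. cos (\<theta> * y)" "\<lambda>y. cos (\<theta> * y)" 1 1]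
      integrable_survive_step[of "\<lambda>y. sin (\<theta> * y)" "\<lambda>y. sin (\<theta> * y)" 1 1]) auto
  also have "\<dots> = expectation (\<lambda>\<omega>. survive X x n \<omega> * cos (\<theta> * partial_sum X n \<omega>)) * expectation (\<lambda>\<omega>. cos (\<theta> * X 0 \<omega>)) -
    expectation (\<lambda>\<omega>. survive X x n \<omega> * sin (\<theta> * partial_sum X n \<omega>)) * expectation (\<lambda>\<omega>. sin (\<theta> * X 0 \<omega>))"
    by (intro arg_cong2[of _ _ _ _ minus]
      expectation_survive_step[of "\<lambda>y. cos (\<theta> * y)" "\<lambda>y. cos (\<theta> * y)" 1 1]
      expectation_survive_step[of "\<lambda>y. sin (\<theta> * y)" "\<lambda>y. sin (\<theta> * y)" 1 1]) auto
  finally show ?thesis .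
qed

lemma integrable_survive:
  assumes "g \<in> borel_measurable borel" and "\<And>y. \<bar>g y\<bar> \<le> B"
  shows "integrable M (\<lambda>\<omega>. survive X x n \<omega> * g (partial_sum X m \<omega>) :: real)"
  using integrable_survive_step[of g "\<lambda>_. 1" B 1 x n m 0] assms by auto

lemma abs_expectation_survive_sin_le:
  "\<bar>expectation (\<lambda>\<omega>. survive X x n \<omega> * sin (\<theta> * partial_sum X n \<omega>))\<bar> \<le> expectation (survive X x n)"
proof -
  have "\<bar>survive X x n \<omega> * sin (\<theta> * partial_sum X n \<omega>)\<bar> \<le> survive X x n \<omega>" for \<omega>
    unfolding abs_mult by (simp add: mult_left_le)
  then show ?thesis
    using integrable_survive[of "\<lambda>_. 1" 1 x n n] integrable_survive[of "\<lambda>y. sin (\<theta> * y)" 1 x n n]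
    by (intro order_trans[OF integral_abs_bound] integral_mono integrable_abs) auto
qed

section \<open>Upper bound for the survival probability at fixed width\<close>

text \<open>The weighted mass \<open>A n\<close> shrinks by a factor of at most
  \<open>C + (\<bar>D\<bar> + q) / c\<close> per step, and \<open>c\<close> times the survival
  probability is below \<open>A n\<close>, since the cosine is at least \<open>c\<close> on
  \<open>[-x, x]\<close>. The jump threshold is chosen so that a surviving path with a short jump
  still has angle at most \<open>pi * (1 - \<delta>\<^sup>2) / 2\<close>, where the cosine is
  nonnegative.\<close>

lemma expectation_survive_upper:
  fixes x \<delta> :: real
  assumes x: "x > 0" and \<delta>: "0 < \<delta>" "\<delta> < 1"
  defines "\<theta> \<equiv> pi * (1 - \<delta>) / (2 * x)" and "c \<equiv> cos (pi * (1 - \<delta>) / 2)"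
  defines "C \<equiv> expectation (\<lambda>\<omega>. cos (\<theta> * X 0 \<omega>))"
    and "D \<equiv> expectation (\<lambda>\<omega>. sin (\<theta> * X 0 \<omega>))"
    and "q \<equiv> expectation (\<lambda>\<omega>. of_bool (\<bar>\<theta> * X 0 \<omega>\<bar> > pi * (1 - \<delta>) * \<delta> / 2))"
  shows "expectation (survive X x n) \<le> exp (- (real n * (1 - C - (\<bar>D\<bar> + q) / c))) / c"
proof -
  define A where "A n = expectation (\<lambda>\<omega>. survive X x n \<omega> * cos (\<theta> * partial_sum X n \<omega>))" for n
  define p where "p n = expectation (survive X x n)" for n
  let ?q = "\<lambda>y. of_bool (\<bar>\<theta> * y\<bar> > pi * (1 - \<delta>) * \<delta> / 2) :: real"
  have [measurable]: "?q \<in> borel_measurable borel"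
    unfolding of_bool_def by measurable
  have \<theta>: "\<theta> > 0" "\<theta> * x = pi * (1 - \<delta>) / 2"
    using x \<delta> by (auto simp: \<theta>_def)
  have c: "c > 0"
    unfolding c_def using \<delta> by (intro cos_gt_zero) auto
  have cos_ge: "c \<le> cos (\<theta> * y)" if "\<bar>y\<bar> \<le> x" for y
  proof -
    have "\<theta> * \<bar>y\<bar> \<le> \<theta> * x"
      using that \<theta> by (intro mult_left_mono) auto
    then have "cos (pi * (1 - \<delta>) / 2) \<le> cos \<bar>\<theta> * y\<bar>"
      using \<theta> \<delta> by (intro cos_monotone_0_pi_le) (auto simp: abs_mult field_simps)
    then show ?thesis
      by (simp add: c_def)
  qed
  have int_p: "integrable M (survive X x n)" for n
    using integrable_survive[of "\<lambda>_. 1" 1 x n n] by simp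
  have int_cos: "integrable M (\<lambda>\<omega>. survive X x n \<omega> * cos (\<theta> * partial_sum X m \<omega>))" for n m
    by (rule integrable_survive[of "\<lambda>y. cos (\<theta> * y)" 1]) auto
  have int_q: "integrable M (\<lambda>\<omega>. survive X x n \<omega> * 1 * ?q (X (Suc n) \<omega>))" for n
    by (rule integrable_survive_step[of "\<lambda>_. 1" ?q 1 1 x n n "Suc n"]) auto
  have cp_le: "c * p n \<le> A n" for n
  proof -
    have "c * survive X x n \<omega> \<le> survive X x n \<omega> * cos (\<theta> * partial_sum X n \<omega>)" for \<omega>
      using survive_cases[of X x n \<omega>] survive_bound[of X x n \<omega>] x cos_ge by auto
    then have "expectation (\<lambda>\<omega>. c * survive X x n \<omega>) \<le> A n"
      unfolding A_def by (intro integral_mono integrable_mult_right int_p int_cos) auto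
    then show ?thesis
      by (simp add: p_def)
  qed
  have p_nonneg: "p n \<ge> 0" for n
    unfolding p_def by (rule integral_nonneg_AE) simp
  have A_nonneg: "A n \<ge> 0" for n
    using cp_le[of n] mult_nonneg_nonneg[of c "p n"] c p_nonneg[of n] by linarith
  have sin_D: "\<bar>expectation (\<lambda>\<omega>. survive X x n \<omega> * sin (\<theta> * partial_sum X n \<omega>)) * D\<bar> \<le> p n * \<bar>D\<bar>" for n
    unfolding abs_mult p_def by (intro mult_right_mono abs_expectation_survive_sin_le) simp
  have step: "A (Suc n) \<le> A n * (C + (\<bar>D\<bar> + q) / c)" for n
  proof -
    \<comment> \<open>Only paths that exit at this step need an argument: after a short jump the
      cosine is still nonnegative, so keeping them can only increase the sum; after a long jump the
      added indicator outweighs \<open>cos \<ge> -1\<close>.\<close>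
    have "survive X x (Suc n) \<omega> * cos (\<theta> * partial_sum X (Suc n) \<omega>) \<le>
        survive X x n \<omega> * cos (\<theta> * partial_sum X (Suc n) \<omega>) + survive X x n \<omega> * 1 * ?q (X (Suc n) \<omega>)" for \<omega>
    proof (cases "survive X x n \<omega> = 1 \<and> \<bar>partial_sum X (Suc n) \<omega>\<bar> > x")
      case True
      let ?S = "partial_sum X (Suc n) \<omega>"
      have "0 \<le> cos (\<theta> * ?S) + ?q (X (Suc n) \<omega>)"
      proof (cases "\<bar>\<theta> * X (Suc n) \<omega>\<bar> > pi * (1 - \<delta>) * \<delta> / 2")
        case True
        then have "?q (X (Suc n) \<omega>) = 1"
          by simp
        then show ?thesis
          using cos_ge_minus_one[of "\<theta> * ?S"] by linarith
      next
        case False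
        have "\<bar>\<theta> * ?S\<bar> \<le> \<theta> * \<bar>partial_sum X n \<omega>\<bar> + \<bar>\<theta> * X (Suc n) \<omega>\<bar>"
          using \<theta> abs_triangle_ineq[of "\<theta> * partial_sum X n \<omega>" "\<theta> * X (Suc n) \<omega>"]
          by (simp add: ring_distribs abs_mult)
        also have "\<dots> \<le> \<theta> * x + pi * (1 - \<delta>) * \<delta> / 2"
          using False True survive_bound[of X x n \<omega>] \<theta> x by (intro add_mono mult_left_mono) auto
        also have "\<dots> = pi / 2 - pi / 2 * \<delta>\<^sup>2"
          unfolding \<theta> by (simp add: field_simps power2_eq_square)
        also have "\<dots> \<le> pi / 2"
          by simp
        finally have "cos (\<theta> * ?S) \<ge> 0"
          by (intro cos_ge_zero) linarith+
        then show ?thesis by simp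
      qed
      with True show ?thesis
        by (simp add: survive_Suc del: partial_sum_Suc)
    next
      case False
      then show ?thesis
        using survive_cases[of X x n \<omega>] by (auto simp: survive_Suc simp del: partial_sum_Suc)
    qed
    then have "A (Suc n) \<le> expectation (\<lambda>\<omega>. survive X x n \<omega> * cos (\<theta> * partial_sum X (Suc n) \<omega>) +
        survive X x n \<omega> * 1 * ?q (X (Suc n) \<omega>))"
      unfolding A_def
      by (intro integral_mono Bochner_Integration.integrable_add int_cos int_q) auto
    also have "\<dots> = A n * C - expectation (\<lambda>\<omega>. survive X x n \<omega> * sin (\<theta> * partial_sum X n \<omega>)) * D + p n * q"
      unfolding A_def C_def D_def p_def q_def
      by (subst Bochner_Integration.integral_add[OF int_cos int_q], subst expectation_survive_cos,
          subst expectation_survive_step[of "\<lambda>_. 1" ?q 1 1]) auto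
    also have "\<dots> \<le> A n * C + p n * \<bar>D\<bar> + p n * q"
      using sin_D by (simp add: abs_le_iff)
    \<comment> \<open>The errors are proportional to \<open>p n\<close>; the bound
      \<open>c * p n \<le> A n\<close> makes them a relative error of the eigenvalue.\<close>
    also have "\<dots> = A n * C + c * p n * ((\<bar>D\<bar> + q) / c)"
      using c by (simp add: field_simps)
    also have "\<dots> \<le> A n * C + A n * ((\<bar>D\<bar> + q) / c)"
    proof -
      have "q \<ge> 0"
        unfolding q_def by (rule integral_nonneg_AE) simp
      then show ?thesis
        using c by (intro add_left_mono mult_right_mono cp_le) auto
    qed
    finally show ?thesis
      by (simp only: distrib_left)
  qed
  \<comment> \<open>The decay factor is \<open>1 - u\<close>, bounded by \<open>exp (- u)\<close>;
    as \<open>A n \<ge> 0\<close>, the induction goes through without knowing the sign of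
    \<open>1 - u\<close>.\<close>
  define u where "u = 1 - C - (\<bar>D\<bar> + q) / c"
  have "A n \<le> exp (- (real n * u))"
  proof (induction n)
    case 0
    then show ?case by (simp add: A_def prob_space)
  next
    case (Suc n)
    have "A (Suc n) \<le> A n * (1 + - u)"
      using step[of n] by (simp add: u_def algebra_simps)
    also have "\<dots> \<le> A n * exp (- u)"
      by (intro mult_left_mono exp_ge_add_one_self A_nonneg)
    also have "\<dots> \<le> exp (- (real n * u)) * exp (- u)"
      by (intro mult_right_mono Suc) auto
    also have "\<dots> = exp (- (real (Suc n) * u))"
      unfolding exp_add[symmetric] by (simp add: algebra_simps)
    finally show ?case .
  qed
  with cp_le[of n] have "c * p n \<le> exp (- (real n * u))"
    by linarith
  then show ?thesis
    using c by (simp add: p_def u_def pos_le_divide_eq mult.commute)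
qed

section \<open>Lower bound for the survival probability at fixed width\<close>

text \<open>The test function \<open>cos (\<theta> * y) + \<eta>\<close> vanishes at
  \<open>\<bar>y\<bar> = x\<close> and is nonpositive for
  \<open>x \<le> \<bar>y\<bar> \<le> 2 * x\<close>, which is as far as a surviving path gets with a
  jump of size at most \<open>x\<close>. A step multiplies the cosine by about \<open>C\<close> but
  leaves \<eta> unchanged, so compared with \<open>C\<close> times the test function there is a
  surplus \<open>\<eta> * (1 - C)\<close>; the hypothesis \<open>slack\<close> lets it pay for
  asymmetry and long jumps.\<close>

lemma expectation_survive_lower:
  fixes x \<delta> :: real
  assumes x: "x > 0" and \<delta>: "0 < \<delta>" "\<delta> \<le> 1/3"
  defines "\<theta> \<equiv> pi * (1 + \<delta>) / (2 * x)" and "\<eta> \<equiv> - cos (pi * (1 + \<delta>) / 2)"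
  defines "C \<equiv> expectation (\<lambda>\<omega>. cos (\<theta> * X 0 \<omega>))"
    and "D \<equiv> expectation (\<lambda>\<omega>. sin (\<theta> * X 0 \<omega>))"
    and "q \<equiv> expectation (\<lambda>\<omega>. of_bool (\<bar>\<theta> * X 0 \<omega>\<bar> > pi * (1 + \<delta>) / 2))"
  assumes C: "0 \<le> C" and slack: "\<bar>D\<bar> + 2 * q \<le> \<eta> * (1 - C)"
  shows "C ^ n \<le> expectation (survive X x n)"
proof -
  let ?h = "\<lambda>y. cos (\<theta> * y) + \<eta>"
  define B where "B n = expectation (\<lambda>\<omega>. survive X x n \<omega> * ?h (partial_sum X n \<omega>))" for n
  define p where "p n = expectation (survive X x n)" for n
  let ?q = "\<lambda>y. of_bool (\<bar>\<theta> * y\<bar> > pi * (1 + \<delta>) / 2) :: real"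
  have [measurable]: "?q \<in> borel_measurable borel"
    unfolding of_bool_def by measurable
  have \<theta>: "\<theta> > 0" "\<theta> * x = pi * (1 + \<delta>) / 2"
    using x \<delta> by (auto simp: \<theta>_def)
  have \<eta>: "\<eta> > 0" "\<eta> \<le> 1"
  proof -
    show "\<eta> > 0"
      unfolding \<eta>_def using \<delta> cos_beyond_right_angle_neg[of \<delta>] by simp
    show "\<eta> \<le> 1"
      unfolding \<eta>_def using cos_ge_minus_one[of "pi * (1 + \<delta>) / 2"] by linarith
  qed
  have h_le: "?h y \<le> 1 + \<eta>" for y
    by simp
  have h_bound: "\<bar>?h y\<bar> \<le> 2" for y
    using \<eta> cos_le_one[of "\<theta> * y"] cos_ge_minus_one[of "\<theta> * y"] by linarith
  have int_p: "integrable M (survive X x n)" for n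
    using integrable_survive[of "\<lambda>_. 1" 1 x n n] by simp
  have int_cos: "integrable M (\<lambda>\<omega>. survive X x n \<omega> * cos (\<theta> * partial_sum X m \<omega>))" for n m
    by (rule integrable_survive[of "\<lambda>y. cos (\<theta> * y)" 1]) auto
  have int_h: "integrable M (\<lambda>\<omega>. survive X x n \<omega> * ?h (partial_sum X m \<omega>))" for n m
    by (rule integrable_survive[of ?h 2]) (use h_bound in auto)
  have int_q: "integrable M (\<lambda>\<omega>. survive X x n \<omega> * 1 * ?q (X (Suc n) \<omega>))" for n
    by (rule integrable_survive_step[of "\<lambda>_. 1" ?q 1 1 x n n "Suc n"]) auto
  have h_neg: "?h y \<le> 0" if "\<bar>y\<bar> > x" "\<bar>\<theta> * y\<bar> \<le> pi * (1 + \<delta>)" for y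
  proof -
    let ?\<alpha> = "pi * (1 + \<delta>) / 2"
    have "\<theta> * x \<le> \<theta> * \<bar>y\<bar>"
      using that \<theta> by (intro mult_left_mono) auto
    then have lo: "?\<alpha> \<le> \<bar>\<theta> * y\<bar>"
      using \<theta> by (simp add: abs_mult)
    have "cos \<bar>\<theta> * y\<bar> \<le> cos ?\<alpha>"
    proof (cases "\<bar>\<theta> * y\<bar> \<le> pi")
      case True
      then show ?thesis
        using lo \<delta> by (intro cos_monotone_0_pi_le) auto
    next
      case False
      \<comment> \<open>Past \<open>pi\<close> the angle is reflected to
        \<open>2 * pi - \<bar>\<theta> * y\<bar>\<close>, which must not fall below
        \<open>?\<alpha>\<close>. With angles up to \<open>2 * ?\<alpha>\<close> this requires
        \<open>3 * ?\<alpha> \<le> 2 * pi\<close>, that is,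
        \<open>\<delta> \<le> 1/3\<close>.\<close>
      have "0 \<le> ?\<alpha>" "3 * ?\<alpha> \<le> 2 * pi" "\<bar>\<theta> * y\<bar> \<le> 2 * ?\<alpha>"
        using \<delta> that by (auto simp: field_simps)
      then have "cos (2 * pi - \<bar>\<theta> * y\<bar>) \<le> cos ?\<alpha>"
        using False by (intro cos_monotone_0_pi_le) linarith+
      then show ?thesis
        by (simp add: cos_diff)
    qed
    then show ?thesis
      by (simp add: \<eta>_def)
  qed
  have p_nonneg: "p n \<ge> 0" for n
    unfolding p_def by (rule integral_nonneg_AE) simp
  have sin_D: "\<bar>expectation (\<lambda>\<omega>. survive X x n \<omega> * sin (\<theta> * partial_sum X n \<omega>)) * D\<bar> \<le> p n * \<bar>D\<bar>" for n
    unfolding abs_mult p_def by (intro mult_right_mono abs_expectation_survive_sin_le) simp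
  have step: "C * B n \<le> B (Suc n)" for n
  proof -
    \<comment> \<open>Killing exited paths removes a nonpositive contribution, except after a long
      jump, where it removes at most \<open>2\<close>; hence the coefficient \<open>2\<close> of the
      indicator.\<close>
    have le: "survive X x n \<omega> * ?h (partial_sum X (Suc n) \<omega>) - 2 * (survive X x n \<omega> * 1 * ?q (X (Suc n) \<omega>)) \<le>
        survive X x (Suc n) \<omega> * ?h (partial_sum X (Suc n) \<omega>)" for \<omega>
    proof (cases "survive X x n \<omega> = 1 \<and> \<bar>partial_sum X (Suc n) \<omega>\<bar> > x")
      case True
      let ?S = "partial_sum X (Suc n) \<omega>"
      have "?h ?S - 2 * ?q (X (Suc n) \<omega>) \<le> 0"
      proof (cases "\<bar>\<theta> * X (Suc n) \<omega>\<bar> > pi * (1 + \<delta>) / 2")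
        case False
        have "\<bar>\<theta> * ?S\<bar> \<le> \<theta> * \<bar>partial_sum X n \<omega>\<bar> + \<bar>\<theta> * X (Suc n) \<omega>\<bar>"
          using \<theta> abs_triangle_ineq[of "\<theta> * partial_sum X n \<omega>" "\<theta> * X (Suc n) \<omega>"]
          by (simp add: ring_distribs abs_mult)
        also have "\<dots> \<le> \<theta> * x + pi * (1 + \<delta>) / 2"
          using False True survive_bound[of X x n \<omega>] \<theta> x by (intro add_mono mult_left_mono) auto
        also have "\<dots> = pi * (1 + \<delta>)"
          unfolding \<theta> by simp
        finally have "?h ?S \<le> 0"
          using True by (intro h_neg) auto
        then show ?thesis using False by simp
      qed (use h_bound[of ?S] in auto)
      with True show ?thesis
        by (simp add: survive_Suc del: partial_sum_Suc)
    next
      case False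
      then show ?thesis
        using survive_cases[of X x n \<omega>] by (auto simp: survive_Suc simp del: partial_sum_Suc)
    qed
    have B_eq: "B n = expectation (\<lambda>\<omega>. survive X x n \<omega> * cos (\<theta> * partial_sum X n \<omega>)) + \<eta> * p n"
    proof -
      have "B n = expectation (\<lambda>\<omega>. survive X x n \<omega> * cos (\<theta> * partial_sum X n \<omega>) + \<eta> * survive X x n \<omega>)"
        by (simp add: B_def algebra_simps)
      then show ?thesis
        by (simp add: p_def Bochner_Integration.integral_add[OF int_cos integrable_mult_right[OF int_p]])
    qed
    \<comment> \<open>The added term is nonnegative by \<open>slack\<close>. The chain then
      reassembles the exact one-step expectation, giving up only the sign of the sine term.\<close>
    have "C * B n \<le> C * B n + p n * (\<eta> * (1 - C) - \<bar>D\<bar> - 2 * q)"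
      using slack p_nonneg[of n] by simp
    also have "\<dots> = (B n - \<eta> * p n) * C - p n * \<bar>D\<bar> + \<eta> * p n - 2 * (p n * q)"
      by (simp add: algebra_simps)
    also have "\<dots> \<le> (B n - \<eta> * p n) * C - expectation (\<lambda>\<omega>. survive X x n \<omega> * sin (\<theta> * partial_sum X n \<omega>)) * D
        + \<eta> * p n - 2 * (p n * q)"
      using sin_D by (simp add: abs_le_iff)
    also have "\<dots> = expectation (\<lambda>\<omega>. survive X x n \<omega> * cos (\<theta> * partial_sum X (Suc n) \<omega>)) + \<eta> * p n - 2 * (p n * q)"
      unfolding B_eq C_def D_def by (simp add: expectation_survive_cos del: partial_sum_Suc)
    also have "\<dots> = expectation (\<lambda>\<omega>. survive X x n \<omega> * cos (\<theta> * partial_sum X (Suc n) \<omega>) + \<eta> * survive X x n \<omega>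
        - 2 * (survive X x n \<omega> * 1 * ?q (X (Suc n) \<omega>)))"
      using expectation_survive_step[of "\<lambda>_. 1" ?q 1 1 x n] int_p int_cos int_q
      by (subst Bochner_Integration.integral_diff, (auto simp del: partial_sum_Suc)[2],
          subst Bochner_Integration.integral_add) (auto simp: p_def q_def simp del: partial_sum_Suc)
    also have "\<dots> = expectation (\<lambda>\<omega>. survive X x n \<omega> * ?h (partial_sum X (Suc n) \<omega>)
        - 2 * (survive X x n \<omega> * 1 * ?q (X (Suc n) \<omega>)))"
      by (simp add: algebra_simps)
    also have "\<dots> \<le> B (Suc n)"
      unfolding B_def using le
      by (intro integral_mono Bochner_Integration.integrable_diff int_h int_q integrable_mult_right) auto
    finally show ?thesis .
  qed
  \<comment> \<open>The walk starts at the maximum \<open>1 + \<eta>\<close> of the test function,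
    so this factor cancels at the end and no constant is lost.\<close>
  have "C ^ n * (1 + \<eta>) \<le> B n"
  proof (induction n)
    case 0
    then show ?case by (simp add: B_def prob_space)
  next
    case (Suc n)
    have "C ^ Suc n * (1 + \<eta>) \<le> C * B n"
      using mult_left_mono[OF Suc C] by (simp add: mult.assoc)
    with step[of n] show ?case by linarith
  qed
  also have "B n \<le> expectation (\<lambda>\<omega>. survive X x n \<omega> * (1 + \<eta>))"
    unfolding B_def using int_p
    by (intro integral_mono int_h mult_left_mono h_le) auto
  also have "\<dots> = p n * (1 + \<eta>)"
    by (simp add: p_def)
  finally show ?thesis
    using \<eta> by (simp add: p_def)
qed

section \<open>Small-angle asymptotics of the step distribution\<close>

text \<open>Dominated convergence three times, each with a constant multiple of
  \<open>(X 0)\<^sup>2\<close> as majorant.\<close>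

lemma small_angle_limits:
  fixes t :: "nat \<Rightarrow> real" and d :: real
  assumes t: "filterlim t (at_right 0) sequentially" and d: "d > 0"
  shows cos_limit: "(\<lambda>k. (1 - expectation (\<lambda>\<omega>. cos (t k * X 0 \<omega>))) / (t k)\<^sup>2) \<longlonglongrightarrow> V / 2"
    and sin_limit: "(\<lambda>k. expectation (\<lambda>\<omega>. sin (t k * X 0 \<omega>)) / (t k)\<^sup>2) \<longlonglongrightarrow> 0"
    and tail_limit: "(\<lambda>k. expectation (\<lambda>\<omega>. of_bool (\<bar>t k * X 0 \<omega>\<bar> > d)) / (t k)\<^sup>2) \<longlonglongrightarrow> 0"
proof -
  have int_cos: "integrable M (\<lambda>\<omega>. cos (s * X 0 \<omega>))" and int_sin: "integrable M (\<lambda>\<omega>. sin (s * X 0 \<omega>))" for s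
    by (auto intro!: integrable_const_bound[where B = 1])
  have t_pos: "\<forall>\<^sub>F k in sequentially. t k > 0"
    using t by (auto simp: filterlim_at eventually_conj_iff)
  have t0: "t \<longlonglongrightarrow> 0"
    using t by (auto simp: filterlim_at)
  have "(\<lambda>k. expectation (\<lambda>\<omega>. (1 - cos (t k * X 0 \<omega>)) / (t k)\<^sup>2)) \<longlonglongrightarrow> expectation (\<lambda>\<omega>. (X 0 \<omega>)\<^sup>2 / 2)"
  proof (rule integral_dominated_convergence[where w = "\<lambda>\<omega>. (X 0 \<omega>)\<^sup>2 / 2"])
    show "integrable M (\<lambda>\<omega>. (X 0 \<omega>)\<^sup>2 / 2)"
      using integrable_X2 by simp
    have "((\<lambda>s. (1 - cos (s * z)) / s\<^sup>2) \<longlongrightarrow> z\<^sup>2 / 2) (at_right 0)" for z :: real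
      unfolding power2_eq_square[of z] by (cases "z = 0", simp, real_asymp)
    from filterlim_compose[OF this t]
    show "AE \<omega> in M. (\<lambda>k. (1 - cos (t k * X 0 \<omega>)) / (t k)\<^sup>2) \<longlonglongrightarrow> (X 0 \<omega>)\<^sup>2 / 2"
      by simp
    have "(1 - cos (s * z)) / s\<^sup>2 \<le> z\<^sup>2 / 2" for s z :: real
    proof -
      have "1 - cos (s * z) = 2 * (sin (s * z / 2))\<^sup>2"
        using cos_double_sin[of "s * z / 2"] by simp
      also have "\<dots> \<le> 2 * (s * z / 2)\<^sup>2"
        by (intro mult_left_mono abs_le_square_iff[THEN iffD1] abs_sin_x_le_abs_x) simp
      finally show ?thesis
        by (cases "s = 0") (auto simp: field_simps)
    qed
    then show "AE \<omega> in M. norm ((1 - cos (t k * X 0 \<omega>)) / (t k)\<^sup>2) \<le> (X 0 \<omega>)\<^sup>2 / 2" for k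
      by simp
  qed auto
  moreover have "expectation (\<lambda>\<omega>. (1 - cos (t k * X 0 \<omega>)) / (t k)\<^sup>2) =
      (1 - expectation (\<lambda>\<omega>. cos (t k * X 0 \<omega>))) / (t k)\<^sup>2" for k
    using int_cos by (simp add: prob_space)
  moreover have "expectation (\<lambda>\<omega>. (X 0 \<omega>)\<^sup>2 / 2) = V / 2"
    by (simp add: second_moment)
  ultimately show "(\<lambda>k. (1 - expectation (\<lambda>\<omega>. cos (t k * X 0 \<omega>))) / (t k)\<^sup>2) \<longlonglongrightarrow> V / 2"
    by (simp only:)
  \<comment> \<open>The linear term has mean zero; subtracting it leaves a remainder of second
    order, which the square dominates.\<close>
  have "(\<lambda>k. expectation (\<lambda>\<omega>. (sin (t k * X 0 \<omega>) - t k * X 0 \<omega>) / (t k)\<^sup>2)) \<longlonglongrightarrow> expectation (\<lambda>\<omega>. 0)"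
  proof (rule integral_dominated_convergence[where w = "\<lambda>\<omega>. (X 0 \<omega>)\<^sup>2 / 2"])
    show "integrable M (\<lambda>\<omega>. (X 0 \<omega>)\<^sup>2 / 2)"
      using integrable_X2 by simp
    have "((\<lambda>s. (sin (s * z) - s * z) / s\<^sup>2) \<longlongrightarrow> 0) (at_right 0)" for z :: real
      by (cases "z = 0", simp, real_asymp)
    from filterlim_compose[OF this t]
    show "AE \<omega> in M. (\<lambda>k. (sin (t k * X 0 \<omega>) - t k * X 0 \<omega>) / (t k)\<^sup>2) \<longlonglongrightarrow> 0"
      by simp
    have "\<bar>sin (s * z) - s * z\<bar> / s\<^sup>2 \<le> z\<^sup>2 / 2" for s z :: real
    proof (cases "s = 0")
      case False
      have "\<bar>sin (s * z) - s * z\<bar> \<le> (s * z)\<^sup>2 / 2"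
        using Maclaurin_sin_bound[of "s * z" 2] by (simp add: numeral_2_eq_2 sin_coeff_def)
      also have "\<dots> = z\<^sup>2 / 2 * s\<^sup>2"
        by (simp add: power_mult_distrib)
      finally show ?thesis
        using False by (simp add: pos_divide_le_eq)
    qed simp
    then show "AE \<omega> in M. norm ((sin (t k * X 0 \<omega>) - t k * X 0 \<omega>) / (t k)\<^sup>2) \<le> (X 0 \<omega>)\<^sup>2 / 2" for k
      by simp
  qed auto
  moreover have "expectation (\<lambda>\<omega>. (sin (t k * X 0 \<omega>) - t k * X 0 \<omega>) / (t k)\<^sup>2) =
      expectation (\<lambda>\<omega>. sin (t k * X 0 \<omega>)) / (t k)\<^sup>2" for k
    using int_sin integrable_X by (simp add: mean_X)
  moreover have "expectation (\<lambda>\<omega>. 0) = (0::real)"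
    by simp
  ultimately show "(\<lambda>k. expectation (\<lambda>\<omega>. sin (t k * X 0 \<omega>)) / (t k)\<^sup>2) \<longlonglongrightarrow> 0"
    by (simp only:)
  have [measurable]: "(\<lambda>\<omega>. of_bool (\<bar>s * X 0 \<omega>\<bar> > d) :: real) \<in> borel_measurable M" for s
    unfolding of_bool_def by measurable
  have "(\<lambda>k. expectation (\<lambda>\<omega>. of_bool (\<bar>t k * X 0 \<omega>\<bar> > d) / (t k)\<^sup>2)) \<longlonglongrightarrow> expectation (\<lambda>\<omega>. 0)"
  proof (rule integral_dominated_convergence[where w = "\<lambda>\<omega>. (X 0 \<omega>)\<^sup>2 / d\<^sup>2"])
    show "integrable M (\<lambda>\<omega>. (X 0 \<omega>)\<^sup>2 / d\<^sup>2)"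
      using integrable_X2 by simp
    have "(\<lambda>k. of_bool (\<bar>t k * z\<bar> > d) / (t k)\<^sup>2 :: real) \<longlonglongrightarrow> 0" for z
    proof (rule tendsto_eventually)
      have "(\<lambda>k. \<bar>t k * z\<bar>) \<longlonglongrightarrow> \<bar>0 * z\<bar>"
        by (intro tendsto_intros t0)
      then have "\<forall>\<^sub>F k in sequentially. \<bar>t k * z\<bar> < d"
        using d by (intro order_tendstoD) auto
      then show "\<forall>\<^sub>F k in sequentially. of_bool (\<bar>t k * z\<bar> > d) / (t k)\<^sup>2 = (0 :: real)"
        by eventually_elim auto
    qed
    then show "AE \<omega> in M. (\<lambda>k. of_bool (\<bar>t k * X 0 \<omega>\<bar> > d) / (t k)\<^sup>2 :: real) \<longlonglongrightarrow> 0"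
      by simp
    \<comment> \<open>The pointwise form of Chebyshev's inequality.\<close>
    have "of_bool (\<bar>s * z\<bar> > d) / s\<^sup>2 \<le> z\<^sup>2 / d\<^sup>2" for s z :: real
    proof (cases "\<bar>s * z\<bar> > d")
      case True
      then have "d\<^sup>2 \<le> (s * z)\<^sup>2" "s \<noteq> 0"
        using d by (auto simp: abs_le_square_iff[symmetric])
      then show ?thesis
        using d by (simp add: field_simps)
    qed simp
    then show "AE \<omega> in M. norm (of_bool (\<bar>t k * X 0 \<omega>\<bar> > d) / (t k)\<^sup>2 :: real) \<le> (X 0 \<omega>)\<^sup>2 / d\<^sup>2" for k
      by simp
  qed auto
  then show "(\<lambda>k. expectation (\<lambda>\<omega>. of_bool (\<bar>t k * X 0 \<omega>\<bar> > d)) / (t k)\<^sup>2) \<longlonglongrightarrow> 0"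
    by simp
qed

section \<open>Power-law rates at width \<open>\<epsilon> * sqrt (n / ln n)\<close>\<close>

text \<open>For \<open>n > 1\<close> the factor \<open>(t n)\<^sup>2 * n / ln n\<close> equals
  \<open>\<kappa>\<^sup>2 / \<epsilon>\<^sup>2\<close> exactly, so a limit relative to
  \<open>(t n)\<^sup>2\<close> becomes one relative to \<open>ln n / n\<close>, the scale on which
  \<open>n\<close> steps produce a power of \<open>n\<close>.\<close>

lemma angle_scale:
  fixes \<kappa> \<epsilon> :: real
  assumes "\<kappa> > 0" "\<epsilon> > 0"
  defines "t \<equiv> \<lambda>n. \<kappa> / (\<epsilon> * sqrt (real n / ln (real n)))"
  shows "filterlim t (at_right 0) sequentially"
    and "f \<longlonglongrightarrow> L \<Longrightarrow> (\<lambda>n. f n * ((t n)\<^sup>2 * real n / ln (real n))) \<longlonglongrightarrow> L * (\<kappa>\<^sup>2 / \<epsilon>\<^sup>2)"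
proof -
  show "filterlim t (at_right 0) sequentially"
    unfolding t_def using assms by real_asymp
  have "\<forall>\<^sub>F n in sequentially. \<kappa>\<^sup>2 / \<epsilon>\<^sup>2 = (t n)\<^sup>2 * real n / ln (real n)"
    using eventually_gt_at_top[of 1] 
  proof eventually_elim
    case (elim n)
    then have "ln (real n) > 0" by simp
    with elim show ?case
      unfolding t_def power_divide power_mult_distrib by (simp add: field_simps)
  qed
  then have "(\<lambda>n. (t n)\<^sup>2 * real n / ln (real n)) \<longlonglongrightarrow> \<kappa>\<^sup>2 / \<epsilon>\<^sup>2"
    by (rule tendsto_eventually[OF eventually_mono]) simp
  then show "f \<longlonglongrightarrow> L \<Longrightarrow> (\<lambda>n. f n * ((t n)\<^sup>2 * real n / ln (real n))) \<longlonglongrightarrow> L * (\<kappa>\<^sup>2 / \<epsilon>\<^sup>2)"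
    by (intro tendsto_mult)
qed

lemma survive_upper_rate:
  assumes \<epsilon>: "\<epsilon> > 0" and b: "b < V * pi\<^sup>2 / (8 * \<epsilon>\<^sup>2)"
  shows "\<exists>K. \<forall>\<^sub>F n in sequentially.
    expectation (survive X (\<epsilon> * sqrt (real n / ln (real n))) n) \<le> K * real n powr - b"
proof -
  \<comment> \<open>The shrunken angle costs a factor \<open>(1 - \<delta>)\<^sup>2\<close> in the
    exponent; for \<delta> close to \<open>0\<close> the exponent stays above \<open>b\<close>. The
    constant \<open>1 / c\<close> depends on \<delta> but not on \<open>n\<close>.\<close>
  have "((\<lambda>\<delta>. V * pi\<^sup>2 * (1 - \<delta>)\<^sup>2 / (8 * \<epsilon>\<^sup>2)) \<longlongrightarrow> V * pi\<^sup>2 * (1 - 0)\<^sup>2 / (8 * \<epsilon>\<^sup>2)) (at_right 0)"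
    using \<epsilon> by (intro tendsto_intros) auto
  then have "\<forall>\<^sub>F \<delta> in at_right 0. b < V * pi\<^sup>2 * (1 - \<delta>)\<^sup>2 / (8 * \<epsilon>\<^sup>2)"
    using b by (intro order_tendstoD) auto
  moreover have "\<forall>\<^sub>F \<delta> in at_right (0::real). \<delta> \<in> {0<..<1}"
    by (rule eventually_at_right_real) simp
  ultimately have "\<forall>\<^sub>F \<delta> in at_right 0. b < V * pi\<^sup>2 * (1 - \<delta>)\<^sup>2 / (8 * \<epsilon>\<^sup>2) \<and> \<delta> \<in> {0<..<1}"
    by eventually_elim simp
  then obtain \<delta> where \<delta>: "0 < \<delta>" "\<delta> < 1" "b < V * pi\<^sup>2 * (1 - \<delta>)\<^sup>2 / (8 * \<epsilon>\<^sup>2)"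
    using eventually_happens[of _ "at_right (0::real)"] by auto
  define \<kappa> where "\<kappa> = pi * (1 - \<delta>) / 2"
  define c where "c = cos \<kappa>"
  define x where "x n = \<epsilon> * sqrt (real n / ln (real n))" for n
  define t where "t n = \<kappa> / x n" for n
  define u where "u n = 1 - expectation (\<lambda>\<omega>. cos (t n * X 0 \<omega>)) -
    (\<bar>expectation (\<lambda>\<omega>. sin (t n * X 0 \<omega>))\<bar> +
      expectation (\<lambda>\<omega>. of_bool (\<bar>t n * X 0 \<omega>\<bar> > pi * (1 - \<delta>) * \<delta> / 2))) / c" for n
  have \<kappa>: "\<kappa> > 0" and d: "pi * (1 - \<delta>) * \<delta> / 2 > 0"
    using \<delta> by (auto simp: \<kappa>_def)
  have c: "c > 0"
    unfolding c_def using \<delta> by (intro cos_gt_zero) (auto simp: \<kappa>_def)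
  have t: "filterlim t (at_right 0) sequentially"
    using angle_scale(1)[OF \<kappa> \<epsilon>] by (simp add: t_def[abs_def] x_def)
  have "(\<lambda>n. (1 - expectation (\<lambda>\<omega>. cos (t n * X 0 \<omega>))) / (t n)\<^sup>2 -
      (\<bar>expectation (\<lambda>\<omega>. sin (t n * X 0 \<omega>)) / (t n)\<^sup>2\<bar> +
      expectation (\<lambda>\<omega>. of_bool (\<bar>t n * X 0 \<omega>\<bar> > pi * (1 - \<delta>) * \<delta> / 2)) / (t n)\<^sup>2) / c)
      \<longlonglongrightarrow> V / 2 - (\<bar>0\<bar> + 0) / c"
    using c by (intro tendsto_intros small_angle_limits t d) auto
  then have "(\<lambda>n. u n / (t n)\<^sup>2) \<longlonglongrightarrow> V / 2"
    by (simp add: u_def diff_divide_distrib add_divide_distrib mult.commute)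
  from angle_scale(2)[OF \<kappa> \<epsilon> this, folded x_def, folded t_def]
  have "(\<lambda>n. u n / (t n)\<^sup>2 * ((t n)\<^sup>2 * real n / ln (real n))) \<longlonglongrightarrow> V / 2 * (\<kappa>\<^sup>2 / \<epsilon>\<^sup>2)" .
  moreover have "V / 2 * (\<kappa>\<^sup>2 / \<epsilon>\<^sup>2) = V * pi\<^sup>2 * (1 - \<delta>)\<^sup>2 / (8 * \<epsilon>\<^sup>2)"
    using \<epsilon> by (simp add: \<kappa>_def power_divide power_mult_distrib)
  ultimately have "\<forall>\<^sub>F n in sequentially. b < u n / (t n)\<^sup>2 * ((t n)\<^sup>2 * real n / ln (real n))"
    using \<delta> by (intro order_tendstoD) auto
  then have "\<forall>\<^sub>F n in sequentially. expectation (survive X (x n) n) \<le> 1 / c * real n powr - b"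
    using eventually_gt_at_top[of 1]
  proof eventually_elim
    case (elim n)
    then have ln: "ln (real n) > 0"
      by simp
    with elim \<epsilon> have x: "x n > 0"
      by (simp add: x_def)
    with \<kappa> have "t n > 0"
      by (simp add: t_def)
    with elim ln have "b * ln (real n) < real n * u n"
      by (simp add: field_simps)
    then have "exp (- (real n * u n)) \<le> real n powr - b"
      using elim by (simp add: powr_def)
    moreover have "expectation (survive X (x n) n) \<le> exp (- (real n * u n)) / c"
      using expectation_survive_upper[OF x \<delta>(1,2), of n]
      by (simp add: u_def t_def c_def \<kappa>_def)
    ultimately show ?case
      using c by (simp add: field_simps)
  qed
  then show ?thesis
    unfolding x_def by blast
qed

text \<open>Serves the lower rate for \<open>V = 0\<close>, where the surplus
  \<open>\<eta> * (1 - C)\<close> has no positive leading term and \<open>slack\<close> cannot be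
  read off from the limits.\<close>

lemma expectation_survive_degenerate:
  assumes "V = 0" "x \<ge> 0"
  shows "expectation (survive X x n) = 1"
proof -
  have "AE \<omega> in M. X 0 \<omega> = 0"
    using integral_nonneg_eq_0_iff_AE[OF integrable_X2] second_moment assms by simp
  then have "expectation (\<lambda>\<omega>. of_bool (X 0 \<omega> \<noteq> 0) :: real) = expectation (\<lambda>\<omega>. 0)"
    by (intro integral_cong_AE) (auto simp: of_bool_def)
  \<comment> \<open>Vanishing passes from \<open>X 0\<close> to every \<open>X k\<close> through the
    mean of an indicator, as \<open>expectation_X_cong\<close> compares expectations.\<close>
  moreover have "expectation (\<lambda>\<omega>. of_bool (X k \<omega> \<noteq> 0) :: real) = expectation (\<lambda>\<omega>. of_bool (X 0 \<omega> \<noteq> 0))" for k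
    by (rule expectation_X_cong) (simp add: of_bool_def)
  moreover have "integrable M (\<lambda>\<omega>. of_bool (X k \<omega> \<noteq> 0) :: real)" for k
    by (rule integrable_const_bound[where B = 1]) (auto simp: of_bool_def)
  ultimately have "AE \<omega> in M. of_bool (X k \<omega> \<noteq> 0) = (0::real)" for k
    by (subst integral_nonneg_eq_0_iff_AE[symmetric]) auto
  then have "AE \<omega> in M. \<forall>k. of_bool (X k \<omega> \<noteq> 0) = (0::real)"
    by (simp add: AE_all_countable)
  then have "AE \<omega> in M. survive X x n \<omega> = 1"
    by eventually_elim (use assms in \<open>simp add: survive_def partial_sum_def\<close>)
  then have "expectation (survive X x n) = expectation (\<lambda>\<omega>. 1)"
    by (intro integral_cong_AE) auto
  then show ?thesis
    by (simp add: prob_space)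
qed

text \<open>With \<open>u = 1 - C\<close>, the bound \<open>C ^ n\<close> is compared with an
  exponential through \<open>1 - u \<ge> exp (- (u / (1 - u)))\<close>; as \<open>u\<close> tends to
  \<open>0\<close>, the denominator does not change the limiting exponent.\<close>

lemma survive_lower_rate:
  assumes \<epsilon>: "\<epsilon> > 0" and b: "b > V * pi\<^sup>2 / (8 * \<epsilon>\<^sup>2)"
  shows "\<forall>\<^sub>F n in sequentially.
    real n powr - b \<le> expectation (survive X (\<epsilon> * sqrt (real n / ln (real n))) n)"
proof (cases "V = 0")
  case True
  with b have "b > 0" by simp
  show ?thesis
    using eventually_gt_at_top[of 1]
  proof eventually_elim
    case (elim n)
    then have "real n powr - b \<le> 1"
      using powr_mono[of "- b" 0 "real n"] \<open>b > 0\<close> by simp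
    with elim \<epsilon> show ?case
      by (simp add: expectation_survive_degenerate[OF True])
  qed
next
  case False
  moreover have "V \<ge> 0"
    using second_moment by (metis integral_nonneg_AE AE_I2 zero_le_power2)
  ultimately have V: "V > 0" by simp
  have "((\<lambda>\<delta>. V * pi\<^sup>2 * (1 + \<delta>)\<^sup>2 / (8 * \<epsilon>\<^sup>2)) \<longlongrightarrow> V * pi\<^sup>2 * (1 + 0)\<^sup>2 / (8 * \<epsilon>\<^sup>2)) (at_right 0)"
    using \<epsilon> by (intro tendsto_intros) auto
  then have "\<forall>\<^sub>F \<delta> in at_right 0. V * pi\<^sup>2 * (1 + \<delta>)\<^sup>2 / (8 * \<epsilon>\<^sup>2) < b"
    using b by (intro order_tendstoD) auto
  moreover have "\<forall>\<^sub>F \<delta> in at_right (0::real). \<delta> \<in> {0<..<1/3}"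
    by (rule eventually_at_right_real) simp
  ultimately have "\<forall>\<^sub>F \<delta> in at_right 0. V * pi\<^sup>2 * (1 + \<delta>)\<^sup>2 / (8 * \<epsilon>\<^sup>2) < b \<and> \<delta> \<in> {0<..<1/3}"
    by eventually_elim simp
  then obtain \<delta> where \<delta>: "0 < \<delta>" "\<delta> \<le> 1/3" "V * pi\<^sup>2 * (1 + \<delta>)\<^sup>2 / (8 * \<epsilon>\<^sup>2) < b"
    using eventually_happens[of _ "at_right (0::real)"] by force
  define \<kappa> where "\<kappa> = pi * (1 + \<delta>) / 2"
  define \<eta> where "\<eta> = - cos \<kappa>"
  define x where "x n = \<epsilon> * sqrt (real n / ln (real n))" for n
  define t where "t n = \<kappa> / x n" for n
  define u where "u n = 1 - expectation (\<lambda>\<omega>. cos (t n * X 0 \<omega>))" for n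
  define w where "w n = \<bar>expectation (\<lambda>\<omega>. sin (t n * X 0 \<omega>))\<bar> +
      2 * expectation (\<lambda>\<omega>. of_bool (\<bar>t n * X 0 \<omega>\<bar> > \<kappa>))" for n
  have \<kappa>: "\<kappa> > 0"
    using \<delta> by (auto simp: \<kappa>_def)
  have \<eta>: "\<eta> > 0"
    unfolding \<eta>_def \<kappa>_def using \<delta> cos_beyond_right_angle_neg[of \<delta>] by simp
  have t: "filterlim t (at_right 0) sequentially"
    using angle_scale(1)[OF \<kappa> \<epsilon>] by (simp add: t_def[abs_def] x_def)
  then have t0: "t \<longlonglongrightarrow> 0" and t_pos: "\<forall>\<^sub>F n in sequentially. t n > 0"
    by (auto simp: filterlim_at eventually_conj_iff)
  have u_lim: "(\<lambda>n. u n / (t n)\<^sup>2) \<longlonglongrightarrow> V / 2"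
    unfolding u_def by (rule cos_limit[OF t \<kappa>])
  \<comment> \<open>The errors are \<open>o(t\<^sup>2)\<close> while the surplus is of order
    \<open>t\<^sup>2\<close> because \<open>V > 0\<close>; this yields the hypothesis
    \<open>slack\<close> for large \<open>n\<close>.\<close>
  have "(\<lambda>n. \<eta> * (u n / (t n)\<^sup>2) - (\<bar>expectation (\<lambda>\<omega>. sin (t n * X 0 \<omega>)) / (t n)\<^sup>2\<bar> +
      2 * (expectation (\<lambda>\<omega>. of_bool (\<bar>t n * X 0 \<omega>\<bar> > \<kappa>)) / (t n)\<^sup>2)))
      \<longlonglongrightarrow> \<eta> * (V / 2) - (\<bar>0\<bar> + 2 * 0)"
    by (intro tendsto_add tendsto_diff tendsto_mult tendsto_rabs tendsto_const u_lim
        sin_limit[OF t \<kappa>] tail_limit[OF t \<kappa>])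
  then have "(\<lambda>n. (\<eta> * u n - w n) / (t n)\<^sup>2) \<longlonglongrightarrow> \<eta> * (V / 2)"
    by (simp add: w_def diff_divide_distrib add_divide_distrib)
  then have "\<forall>\<^sub>F n in sequentially. 0 < (\<eta> * u n - w n) / (t n)\<^sup>2"
    by (rule order_tendstoD) (use \<eta> V in simp)
  then have slack: "\<forall>\<^sub>F n in sequentially. w n \<le> \<eta> * u n"
    by eventually_elim (auto simp: zero_less_divide_iff)
  have "(\<lambda>n. u n / (t n)\<^sup>2 * (t n)\<^sup>2) \<longlonglongrightarrow> V / 2 * 0\<^sup>2"
    by (intro tendsto_mult[OF u_lim] tendsto_power t0)
  moreover have "\<forall>\<^sub>F n in sequentially. u n / (t n)\<^sup>2 * (t n)\<^sup>2 = u n"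
    using t_pos by eventually_elim simp
  ultimately have u0: "u \<longlonglongrightarrow> 0"
    using Lim_transform_eventually by fastforce
  \<comment> \<open>Gives \<open>C \<ge> 0\<close>, required by the lower bound, and makes division
    by \<open>1 - u n\<close> legitimate.\<close>
  then have u_lt: "\<forall>\<^sub>F n in sequentially. u n < 1"
    by (intro order_tendstoD) auto
  have "(\<lambda>n. u n / (t n)\<^sup>2 / (1 - u n)) \<longlonglongrightarrow> V / 2 / (1 - 0)"
    by (intro tendsto_divide[OF u_lim] tendsto_diff tendsto_const u0) simp
  from angle_scale(2)[OF \<kappa> \<epsilon> this, folded x_def, folded t_def]
  have "(\<lambda>n. u n / (t n)\<^sup>2 / (1 - u n) * ((t n)\<^sup>2 * real n / ln (real n))) \<longlonglongrightarrow> V / 2 * (\<kappa>\<^sup>2 / \<epsilon>\<^sup>2)"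
    by simp
  moreover have "V / 2 * (\<kappa>\<^sup>2 / \<epsilon>\<^sup>2) = V * pi\<^sup>2 * (1 + \<delta>)\<^sup>2 / (8 * \<epsilon>\<^sup>2)"
    using \<epsilon> by (simp add: \<kappa>_def power_divide power_mult_distrib)
  ultimately have "\<forall>\<^sub>F n in sequentially. u n / (t n)\<^sup>2 / (1 - u n) * ((t n)\<^sup>2 * real n / ln (real n)) < b"
    using \<delta> by (intro order_tendstoD) auto
  then have "\<forall>\<^sub>F n in sequentially. real n powr - b \<le> expectation (survive X (x n) n)"
    using eventually_gt_at_top[of 1] slack u_lt
  proof eventually_elim
    case (elim n)
    then have ln: "ln (real n) > 0"
      by simp
    with elim \<epsilon> have x: "x n > 0"
      by (simp add: x_def)
    with \<kappa> have "t n > 0"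
      by (simp add: t_def)
    then have "u n / (t n)\<^sup>2 / (1 - u n) * ((t n)\<^sup>2 * real n / ln (real n)) =
        real n * (u n / (1 - u n)) / ln (real n)"
      by simp
    with elim ln have "real n * (u n / (1 - u n)) < b * ln (real n)"
      by (simp only: pos_divide_less_eq)
    then have "real n powr - b \<le> exp (real n * - (u n / (1 - u n)))"
      using elim by (simp add: powr_def)
    also have "\<dots> = inverse (exp (u n / (1 - u n))) ^ n"
      by (simp only: exp_of_nat_mult exp_minus)
    also have "\<dots> \<le> (1 - u n) ^ n"
    proof (rule power_mono)
      have "1 / (1 - u n) \<le> exp (u n / (1 - u n))"
        using exp_ge_add_one_self[of "u n / (1 - u n)"] elim by (simp add: field_simps)
      then show "inverse (exp (u n / (1 - u n))) \<le> 1 - u n"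
        using elim by (simp add: field_simps)
    qed simp
    also have "\<dots> \<le> expectation (survive X (x n) n)"
      using expectation_survive_lower[OF x \<delta>(1,2), of n] elim
      by (simp add: u_def w_def t_def \<eta>_def \<kappa>_def)
    finally show ?case .
  qed
  then show ?thesis
    unfolding x_def by blast
qed

section \<open>From survival probabilities to the series\<close>

lemma prob_max_abs_sum_le:
  assumes "n \<ge> 1"
  shows "\<P>(\<omega> in M. max_abs_sum X n \<omega> \<le> x) = expectation (survive X x n)"
proof -
  have eq: "max_abs_sum X n \<omega> \<le> x \<longleftrightarrow> survive X x n \<omega> = 1" for \<omega>
    using assms by (auto simp: max_abs_sum_def survive_def)
  have "survive X x n \<omega> = indicator {\<omega> \<in> space M. survive X x n \<omega> = 1} \<omega>" if "\<omega> \<in> space M" for \<omega>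
    using survive_cases[of X x n \<omega>] that by (auto simp: indicator_def)
  then have "expectation (survive X x n) = expectation (indicator {\<omega> \<in> space M. survive X x n \<omega> = 1})"
    by (rule Bochner_Integration.integral_cong[OF refl])
  then show ?thesis
    by (simp add: eq)
qed

lemma eventually_Log_eq_ln: "\<forall>\<^sub>F n in sequentially. Log (real n) = ln (real n)"
proof -
  have "\<forall>\<^sub>F n in sequentially. real n \<ge> exp 1"
    using filterlim_real_sequentially by (simp add: filterlim_at_top)
  then show ?thesis
    by eventually_elim (simp add: Log_def max_absorb1)
qed

text \<open>The real-valued summand, indexed by \<open>n\<close> itself rather than by its
  predecessor. The extra index \<open>0\<close> does not affect summability.\<close>

definition small_dev_term :: "real \<Rightarrow> real \<Rightarrow> real \<Rightarrow> nat \<Rightarrow> real" where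
  "small_dev_term r a \<epsilon> n = real n powr (r - 2) * Log (real n) powr a *
    \<P>(\<omega> in M. max_abs_sum X n \<omega> \<le> \<epsilon> * sqrt (real n / Log (real n)))"

lemma small_dev_term_nonneg: "small_dev_term r a \<epsilon> n \<ge> 0"
  by (simp add: small_dev_term_def)

lemma small_dev_series_finite_iff:
  "small_dev_series M X r a \<epsilon> < \<infinity> \<longleftrightarrow> summable (small_dev_term r a \<epsilon>)"
proof -
  have eq: "small_dev_series M X r a \<epsilon> = (\<Sum>i. ennreal (small_dev_term r a \<epsilon> (Suc i)))"
    unfolding small_dev_series_def small_dev_term_def Let_def ..
  have "small_dev_series M X r a \<epsilon> < \<infinity> \<longleftrightarrow> summable (\<lambda>i. small_dev_term r a \<epsilon> (Suc i))"
  proof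
    assume "small_dev_series M X r a \<epsilon> < \<infinity>"
    then show "summable (\<lambda>i. small_dev_term r a \<epsilon> (Suc i))"
      unfolding eq by (intro summable_suminf_not_top small_dev_term_nonneg) auto
  next
    assume "summable (\<lambda>i. small_dev_term r a \<epsilon> (Suc i))"
    then show "small_dev_series M X r a \<epsilon> < \<infinity>"
      unfolding eq by (subst suminf_ennreal2) (auto intro: small_dev_term_nonneg)
  qed
  then show ?thesis
    by (simp add: summable_Suc_iff)
qed

lemma eventually_small_dev_term:
  "\<forall>\<^sub>F n in sequentially. small_dev_term r a \<epsilon> n = real n powr (r - 2) * ln (real n) powr a *
    expectation (survive X (\<epsilon> * sqrt (real n / ln (real n))) n)"
  using eventually_Log_eq_ln eventually_ge_at_top[of 1]
  by eventually_elim (simp add: small_dev_term_def prob_max_abs_sum_le)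

lemma summable_small_dev_term:
  assumes "\<epsilon> > 0" and "r - 1 < V * pi\<^sup>2 / (8 * \<epsilon>\<^sup>2)"
  shows "summable (small_dev_term r a \<epsilon>)"
proof -
  obtain b where b: "r - 1 < b" "b < V * pi\<^sup>2 / (8 * \<epsilon>\<^sup>2)"
    using dense[OF assms(2)] by blast
  obtain K where K: "\<forall>\<^sub>F n in sequentially.
      expectation (survive X (\<epsilon> * sqrt (real n / ln (real n))) n) \<le> K * real n powr - b"
    using survive_upper_rate[OF assms(1) b(2)] by blast
  \<comment> \<open>Half of the gap absorbs the power of the logarithm; the other half leaves the
    summable exponent \<open>- 1 - \<rho>\<close>.\<close>
  define \<rho> where "\<rho> = (b - (r - 1)) / 2"
  have \<rho>: "\<rho> > 0" "r - 2 + \<rho> + - b = - 1 - \<rho>"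
    using b by (auto simp: \<rho>_def field_simps)
  have "\<forall>\<^sub>F n in sequentially. ln (real n) powr a \<le> real n powr \<rho>"
    using \<rho>(1) by real_asymp
  then have "\<forall>\<^sub>F n in sequentially. norm (small_dev_term r a \<epsilon> n) \<le> K * real n powr (- 1 - \<rho>)"
    using K eventually_small_dev_term[of r a \<epsilon>] eventually_gt_at_top[of 0]
  proof eventually_elim
    case (elim n)
    have "small_dev_term r a \<epsilon> n \<le> real n powr (r - 2) * real n powr \<rho> * (K * real n powr - b)"
      unfolding elim(3) using elim by (intro mult_mono mult_left_mono) (auto intro!: integral_nonneg_AE)
    also have "\<dots> = K * (real n powr (r - 2) * real n powr \<rho> * real n powr - b)"
      by simp
    also have "\<dots> = K * real n powr (- 1 - \<rho>)"
      unfolding powr_add[symmetric] \<rho>(2) ..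
    finally show ?case
      by (simp add: small_dev_term_nonneg)
  qed
  moreover have "summable (\<lambda>n. K * real n powr (- 1 - \<rho>))"
    using \<rho>(1) by (intro summable_mult) (simp add: summable_real_powr_iff)
  ultimately show ?thesis
    by (rule summable_comparison_test_ev)
qed

lemma not_summable_small_dev_term:
  assumes "\<epsilon> > 0" and "V * pi\<^sup>2 / (8 * \<epsilon>\<^sup>2) < r - 1"
  shows "\<not> summable (small_dev_term r a \<epsilon>)"
proof
  assume sum: "summable (small_dev_term r a \<epsilon>)"
  obtain b where b: "V * pi\<^sup>2 / (8 * \<epsilon>\<^sup>2) < b" "b < r - 1"
    using dense[OF assms(2)] by blast
  \<comment> \<open>The whole gap goes to the logarithm, since the harmonic series already
    diverges.\<close>
  define \<rho> where "\<rho> = r - 1 - b"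
  have \<rho>: "\<rho> > 0" "r - 2 + - \<rho> + - b = - 1"
    using b by (auto simp: \<rho>_def)
  have "\<forall>\<^sub>F n in sequentially. real n powr - \<rho> \<le> ln (real n) powr a"
    using \<rho>(1) by real_asymp
  then have "\<forall>\<^sub>F n in sequentially. norm (real n powr - 1) \<le> small_dev_term r a \<epsilon> n"
    using survive_lower_rate[OF assms(1) b(1)] eventually_small_dev_term[of r a \<epsilon>]
  proof eventually_elim
    case (elim n)
    have "real n powr - 1 = real n powr (r - 2) * real n powr - \<rho> * real n powr - b"
      unfolding powr_add[symmetric] \<rho>(2) ..
    also have "\<dots> \<le> small_dev_term r a \<epsilon> n"
      unfolding elim(3) using elim by (intro mult_mono mult_left_mono) auto
    finally show ?case by simp
  qed
  from summable_comparison_test_ev[OF this sum] show False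
    unfolding summable_real_powr_iff by simp
qed

end

theorem theorem1p1:
  fixes M :: "'a measure" and X :: "nat \<Rightarrow> 'a \<Rightarrow> real" and \<sigma> r a :: real
  assumes "prob_space M"
    and "iid M X"
    and "integrable M (X 0)"
    and "prob_space.expectation M (X 0) = 0"
    and "integrable M (\<lambda>\<omega>. (X 0 \<omega>)\<^sup>2)"
    and "prob_space.variance M (X 0) = \<sigma>\<^sup>2"
    and "\<sigma> \<ge> 0"
    and "r > 1"
  shows "(\<forall>\<epsilon>>0. \<epsilon> < \<sigma> * sqrt (pi\<^sup>2 / (8 * (r - 1))) \<longrightarrow>
            small_dev_series M X r a \<epsilon> < \<infinity>) \<and>
         (\<forall>\<epsilon>. \<epsilon> > \<sigma> * sqrt (pi\<^sup>2 / (8 * (r - 1))) \<longrightarrow>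
            small_dev_series M X r a \<epsilon> = \<infinity>)"
proof -
  interpret prob_space M by fact
  interpret centered_walk M X "\<sigma>\<^sup>2"
    using assms by unfold_locales auto
  let ?e = "\<sigma> * sqrt (pi\<^sup>2 / (8 * (r - 1)))"
  have e_nonneg: "?e \<ge> 0"
    using assms by simp
  \<comment> \<open>Squaring turns the comparison of \<epsilon> with the threshold into that of
    \<open>r - 1\<close> with
    \<open>\<sigma>\<^sup>2 * pi\<^sup>2 / (8 * \<epsilon>\<^sup>2)\<close>.\<close>
  have e_sq: "?e\<^sup>2 = \<sigma>\<^sup>2 * pi\<^sup>2 / (8 * (r - 1))"
    unfolding power_mult_distrib using assms(8) by (subst real_sqrt_pow2) auto
  show ?thesis
  proof (intro conjI allI impI)
    fix \<epsilon> :: real assume "\<epsilon> > 0" "\<epsilon> < ?e"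
    then have "\<epsilon>\<^sup>2 < ?e\<^sup>2"
      by (intro power_strict_mono) auto
    with \<open>\<epsilon> > 0\<close> assms(8) show "small_dev_series M X r a \<epsilon> < \<infinity>"
      unfolding e_sq small_dev_series_finite_iff
      by (intro summable_small_dev_term) (auto simp: field_simps)
  next
    fix \<epsilon> :: real assume "\<epsilon> > ?e"
    then have "\<epsilon> > 0" "?e\<^sup>2 < \<epsilon>\<^sup>2"
      using e_nonneg by (linarith, intro power_strict_mono) auto
    with assms(8) have "\<not> summable (small_dev_term r a \<epsilon>)"
      unfolding e_sq by (intro not_summable_small_dev_term) (auto simp: field_simps)
    then show "small_dev_series M X r a \<epsilon> = \<infinity>"
      unfolding small_dev_series_finite_iff[symmetric] by (metis infinity_ennreal_def less_top)
  qed
qed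

end
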